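(* Let $N\ge 1$ be an integer and let $b$ be a symmetric bilinear form on the real Lie algebra $\mathfrak{sp}(2N,\mathbb R)$ such that $$b(\operatorname{Ad}_S X,\operatorname{Ad}_S Y)=b(X,Y)\qquad\text{for every } S\in \operatorname{Sp}(2N,\mathbb R)\text{ and all }X,Y\in\mathfrak{sp}(2N,\mathbb R).$$ Then there is a real number $c$ such that $b=c\,\tau$, where $\tau(X,Y)=\operatorname{Tr}(XY)$. Consequently, $b$ is either degenerate or indefinite; in particular $b$ is not positive definite (so it cannot define a positive-definite quadratic Nielsen cost on $\mathfrak{sp}(2N,\mathbb R)$).
   Context: $\operatorname{Sp}(2N,\mathbb R)$ is the group of real $2N\times 2N$ matrices $S$ with $S\Omega_{2N}S^{\mathsf T}=\Omega_{2N}$, where $\Omega_{2N}$ is the direct sum of $N$ copies of $\begin{pmatrix}0&1\\-1&0\end{pmatrix}$; $\mathfrak{sp}(2N,\mathbb R)$ is its Lie algebra (real $2N\times 2N$ matrices $X$ with $X\Omega_{2N}+\Omega_{2N}X^{\mathsf T}=0$), and $\operatorname{Ad}_S X=SXS^{-1}$. A quadratic Nielsen cost is a fixed positive-definite quadratic form on the gate Lie algebra. "Indefinite" means taking both strictly positive and strictly negative values on the diagonal. *)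

theory Defs
  imports "HOL-Analysis.Analysis"
begin

text \<open>
  The \<open>N\<close> blocks are indexed by a finite type \<open>'n\<close>, so that \<open>N = CARD('n) \<ge> 1\<close>, and the two
  positions inside a block by \<open>2\<close>.  A pair \<open>(i, a) :: 'n \<times> 2\<close> is thus position \<open>a\<close> of block \<open>i\<close>,
  and \<open>CARD('n \<times> 2) = 2 * N\<close>.
\<close>

type_synonym 'n mat2N = "real ^ ('n \<times> 2) ^ ('n \<times> 2)"

definition J2 :: "real ^ 2 ^ 2" where
  "J2 = vector [vector [0, 1], vector [- 1, 0]]"

definition Omega :: "'n::finite mat2N" where
  "Omega = (\<chi> p q. if fst p = fst q then J2 $ snd p $ snd q else 0)"

definition Sp :: "'n::finite mat2N set" where
  "Sp = {S. S ** Omega ** transpose S = Omega}"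

definition sp :: "'n::finite mat2N set" where
  "sp = {X. X ** Omega + Omega ** transpose X = 0}"

definition Ad :: "'n::finite mat2N \<Rightarrow> 'n mat2N \<Rightarrow> 'n mat2N" where
  "Ad S X = S ** X ** matrix_inv S"

text \<open>
  Forms on a linear subspace \<open>V\<close> are functions on the ambient space of which only the values on
  \<open>V\<close> matter.
\<close>

definition bilinear_form_on :: "'v::real_vector set \<Rightarrow> ('v \<Rightarrow> 'v \<Rightarrow> real) \<Rightarrow> bool" where
  "bilinear_form_on V b \<longleftrightarrow>
     (\<forall>X\<in>V. \<forall>Y\<in>V. \<forall>Z\<in>V. b (X + Y) Z = b X Z + b Y Z \<and> b Z (X + Y) = b Z X + b Z Y) \<and>
     (\<forall>r. \<forall>X\<in>V. \<forall>Y\<in>V. b (r *\<^sub>R X) Y = r * b X Y \<and> b X (r *\<^sub>R Y) = r * b X Y)"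

definition symmetric_form_on :: "'v set \<Rightarrow> ('v \<Rightarrow> 'v \<Rightarrow> real) \<Rightarrow> bool" where
  "symmetric_form_on V b \<longleftrightarrow> (\<forall>X\<in>V. \<forall>Y\<in>V. b X Y = b Y X)"

definition degenerate_on :: "'v::real_vector set \<Rightarrow> ('v \<Rightarrow> 'v \<Rightarrow> real) \<Rightarrow> bool" where
  "degenerate_on V b \<longleftrightarrow> (\<exists>X\<in>V. X \<noteq> 0 \<and> (\<forall>Y\<in>V. b X Y = 0))"

definition indefinite_on :: "'v set \<Rightarrow> ('v \<Rightarrow> 'v \<Rightarrow> real) \<Rightarrow> bool" where
  "indefinite_on V b \<longleftrightarrow> (\<exists>X\<in>V. b X X > 0) \<and> (\<exists>X\<in>V. b X X < 0)"

definition positive_definite_on :: "'v::real_vector set \<Rightarrow> ('v \<Rightarrow> 'v \<Rightarrow> real) \<Rightarrow> bool" where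
  "positive_definite_on V b \<longleftrightarrow> (\<forall>X\<in>V. X \<noteq> 0 \<longrightarrow> b X X > 0)"

definition quadratic_Nielsen_cost_on :: "'v::real_vector set \<Rightarrow> ('v \<Rightarrow> real) \<Rightarrow> bool" where
  "quadratic_Nielsen_cost_on V Q \<longleftrightarrow>
     (\<exists>q. bilinear_form_on V q \<and> symmetric_form_on V q \<and> positive_definite_on V q \<and>
          (\<forall>X\<in>V. Q X = q X X))"

end

theory Submission
  imports Defs
begin

text \<open>
  Write \<open>\<omega>(v, w) = v\<^sup>T \<Omega> w\<close>.  The algebra \<open>sp\<close> is spanned by the squares \<open>sq v = v v\<^sup>T \<Omega>\<close>, and
  \<open>Ad S (sq v) = sq (S v)\<close>, so \<open>b\<close> is determined by the invariant function \<open>f(v, w) = b (sq v) (sq w)\<close>,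
  which is homogeneous quadratic in each variable.  Symplectic transvections that fix \<open>v\<close> act
  transitively on the vectors \<open>w\<close> with a given value \<open>\<omega>(v, w) \<noteq> 0\<close>; hence
  \<open>f(v, w) = g(v) \<omega>(v, w)\<^sup>2\<close> for such \<open>w\<close>, and by symmetry of \<open>f\<close> the factor \<open>g\<close> is constant.
  The parallelogram law removes the restriction \<open>\<omega>(v, w) \<noteq> 0\<close>.  Since
  \<open>Tr (sq v \<cdot> sq w) = - \<omega>(v, w)\<^sup>2\<close>, \<open>b\<close> is a multiple of the trace form, which vanishes on \<open>sq v\<close> and
  takes opposite signs on \<open>sq v + sq w\<close> and \<open>sq v - sq w\<close>.
\<close>

section \<open>Matrix identities and rank-one matrices\<close>

lemma matrix_add_rdistrib: "(A + B) ** C = A ** C + B ** C"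
  for A B :: "real ^ 'm::finite ^ 'k" and C :: "real ^ 'l ^ 'm"
  by (simp add: vec_eq_iff matrix_matrix_mult_def distrib_right sum.distrib)

lemma matrix_diff_ldistrib: "A ** (B - C) = A ** B - A ** C"
  for A :: "real ^ 'm::finite ^ 'k" and B C :: "real ^ 'l ^ 'm"
  by (simp add: vec_eq_iff matrix_matrix_mult_def right_diff_distrib sum_subtractf)

lemma matrix_mult_0_left: "0 ** A = 0"
  for A :: "real ^ 'l ^ 'm::finite"
  by (simp add: vec_eq_iff matrix_matrix_mult_def)

lemma transpose_add: "transpose (A + B) = transpose A + transpose B"
  by (simp add: vec_eq_iff transpose_def)

lemma matrix_vector_mult_minus_left: "(- A) *v x = - (A *v x)"
  for A :: "real ^ 'm::finite ^ 'k"
  by (simp add: vec_eq_iff matrix_vector_mult_def sum_negf)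

lemma matrix_mult_minus_left: "(- A) ** B = - (A ** B)"
  and matrix_mult_minus_right: "A ** (- B) = - (A ** B)"
  for A :: "real ^ 'm::finite ^ 'k" and B :: "real ^ 'l ^ 'm"
  by (simp_all add: vec_eq_iff matrix_matrix_mult_def sum_negf)

lemma transpose_minus: "transpose (- A) = - transpose A"
  by (simp add: vec_eq_iff transpose_def)

lemma trace_scaleR: "trace (r *\<^sub>R A) = r * trace A"
  for A :: "real ^ 'm::finite ^ 'm"
  by (simp add: trace_def sum_distrib_left)

definition outer :: "real ^ 'm \<Rightarrow> real ^ 'm \<Rightarrow> real ^ 'm ^ 'm" where
  "outer v w = (\<chi> i j. v $ i * w $ j)"

lemma matrix_mult_outer: "A ** outer v w = outer (A *v v) w"
  for v w :: "real ^ 'm::finite"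
  by (simp add: vec_eq_iff outer_def matrix_matrix_mult_def matrix_vector_mult_def
      sum_distrib_left mult_ac)

lemma outer_mult_matrix: "outer v w ** A = outer v (transpose A *v w)"
  for v w :: "real ^ 'm::finite"
  by (simp add: vec_eq_iff outer_def matrix_matrix_mult_def matrix_vector_mult_def
      transpose_def sum_distrib_left mult_ac)

lemma outer_mult_vector: "outer v w *v x = (w \<bullet> x) *\<^sub>R v"
  for v w :: "real ^ 'm::finite"
  by (simp add: vec_eq_iff outer_def matrix_vector_mult_def inner_vec_def
      sum_distrib_left mult_ac)

lemma transpose_outer: "transpose (outer v w) = outer w v"
  by (simp add: vec_eq_iff outer_def transpose_def mult_ac)

lemma trace_outer: "trace (outer v w) = v \<bullet> w"
  for v w :: "real ^ 'm::finite"
  by (simp add: outer_def trace_def inner_vec_def)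

lemma outer_add_left: "outer (u + v) w = outer u w + outer v w"
  and outer_add_right: "outer w (u + v) = outer w u + outer w v"
  and outer_scaleR_left: "outer (r *\<^sub>R u) w = r *\<^sub>R outer u w"
  and outer_scaleR_right: "outer w (r *\<^sub>R u) = r *\<^sub>R outer w u"
  by (simp_all add: vec_eq_iff outer_def algebra_simps)

text \<open>Polarization: with \<open>?s v = outer v v\<close>, the difference
  \<open>?s (p + q) - ?s p - ?s q\<close> equals \<open>outer p q + outer q p\<close>. Weighting it
  by half the entries of \<open>A\<close> over pairs of unit vectors gives half of \<open>A\<close>
  plus half of its transpose.\<close>

lemma symmetric_matrix_in_span_squares:
  fixes A :: "real ^ 'm::finite ^ 'm"
  assumes "transpose A = A"
  shows "A \<in> span (range (\<lambda>v. outer v v))"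
proof -
  let ?e = "\<lambda>p. axis p 1 :: real ^ 'm"
  let ?s = "\<lambda>v::real ^ 'm. outer v v"
  have sym: "A $ q $ p = A $ p $ q" for p q
    using assms by (metis transpose_def vec_lambda_beta)
  have unit: "(\<Sum>p\<in>UNIV. \<Sum>q\<in>UNIV. A $ p $ q *\<^sub>R outer (?e p) (?e q)) = A"
  proof -
    have "(\<Sum>p\<in>UNIV. \<Sum>q\<in>UNIV. A $ p $ q *\<^sub>R outer (?e p) (?e q)) $ i $ j
        = (\<Sum>p\<in>UNIV. \<Sum>q\<in>UNIV. if q = j then if p = i then A $ p $ q else 0 else 0)" for i j
      unfolding sum_component by (intro sum.cong refl) (simp add: outer_def axis_def)
    then show ?thesis
      by (simp add: vec_eq_iff)
  qed
  have unit': "(\<Sum>p\<in>UNIV. \<Sum>q\<in>UNIV. A $ p $ q *\<^sub>R outer (?e q) (?e p)) = A"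
    by (subst sum.swap) (simp add: sym unit)
  have "(\<Sum>p\<in>UNIV. \<Sum>q\<in>UNIV. (A $ p $ q / 2) *\<^sub>R (?s (?e p + ?e q) - ?s (?e p) - ?s (?e q)))
      = (\<Sum>p\<in>UNIV. \<Sum>q\<in>UNIV. (1/2) *\<^sub>R (A $ p $ q *\<^sub>R outer (?e p) (?e q))
          + (1/2) *\<^sub>R (A $ p $ q *\<^sub>R outer (?e q) (?e p)))"
    by (intro sum.cong refl) (simp add: outer_add_left outer_add_right algebra_simps)
  also have "\<dots> = (1/2) *\<^sub>R A + (1/2) *\<^sub>R A"
    by (simp only: sum.distrib scaleR_right.sum[symmetric] unit unit')
  also have "\<dots> = A"
    by (simp flip: scaleR_add_left)
  finally have "A = (\<Sum>p\<in>UNIV. \<Sum>q\<in>UNIV.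
      (A $ p $ q / 2) *\<^sub>R (?s (?e p + ?e q) - ?s (?e p) - ?s (?e q)))" ..
  also have "\<dots> \<in> span (range ?s)"
    by (intro span_sum span_scale span_diff span_base rangeI)
  finally show ?thesis .
qed

section \<open>The matrix \<open>Omega\<close> and the symplectic form\<close>

lemma transpose_Omega: "transpose Omega = (- Omega :: 'n::finite mat2N)"
proof -
  have J: "J2 $ a $ b = - (J2 $ b $ a)" for a b
    using exhaust_2[of a] exhaust_2[of b] by (auto simp: J2_def)
  have "transpose Omega $ p $ q = (- Omega :: 'n mat2N) $ p $ q" for p q
    using J[of "snd q" "snd p"] by (simp add: Omega_def transpose_def)
  then show ?thesis
    by (simp only: vec_eq_iff simp_thms)
qed

lemma Omega_mult_Omega: "Omega ** Omega = (- mat 1 :: 'n::finite mat2N)"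
proof -
  have J: "(\<Sum>k\<in>UNIV. J2 $ a $ k * J2 $ k $ b) = - (if a = b then 1 else 0)" for a b
    using exhaust_2[of a] exhaust_2[of b] by (auto simp: J2_def UNIV_2)
  have "(\<Sum>k\<in>UNIV. (Omega :: 'n mat2N) $ (i, a) $ k * (Omega :: 'n mat2N) $ k $ (j, b))
      = - (if (i, a) = (j, b) then 1 else 0)" for i j a b
  proof -
    \<comment> \<open>The sum over pairs splits into a block index \<open>l\<close> and a position
      \<open>k\<close>; only the block \<open>l = i\<close> contributes, which leaves an entry of
      \<open>J2\<close> squared.\<close>
    have "(\<Sum>k\<in>UNIV. (Omega :: 'n mat2N) $ (i, a) $ k * (Omega :: 'n mat2N) $ k $ (j, b))
        = (\<Sum>l\<in>UNIV. \<Sum>k\<in>UNIV.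
            if l = i then if i = j then J2 $ a $ k * J2 $ k $ b else 0 else 0)"
      unfolding UNIV_Times_UNIV[symmetric] sum.cartesian_product'
      by (intro sum.cong refl) (auto simp: Omega_def)
    also have "\<dots> = (\<Sum>k\<in>UNIV. if i = j then J2 $ a $ k * J2 $ k $ b else 0)"
      by (subst sum.swap) simp
    also have "\<dots> = - (if (i, a) = (j, b) then 1 else 0)"
      by (cases "i = j") (simp_all add: J)
    finally show ?thesis .
  qed
  then show ?thesis
    by (simp add: vec_eq_iff matrix_matrix_mult_def mat_def split_paired_all)
qed

definition omega :: "real ^ ('n::finite \<times> 2) \<Rightarrow> real ^ ('n \<times> 2) \<Rightarrow> real" where
  "omega v w = v \<bullet> (Omega *v w)"

lemma omega_add_left: "omega (u + v) w = omega u w + omega v w"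
  and omega_add_right: "omega w (u + v) = omega w u + omega w v"
  and omega_diff_left: "omega (u - v) w = omega u w - omega v w"
  and omega_diff_right: "omega w (u - v) = omega w u - omega w v"
  and omega_scaleR_right: "omega w (r *\<^sub>R u) = r * omega w u"
  by (simp_all add: omega_def inner_left_distrib inner_right_distrib inner_diff_left
      inner_diff_right matrix_vector_right_distrib matrix_vector_mult_diff_distrib
      matrix_vector_mult_scaleR)

lemma omega_commute: "omega w v = - omega v w"
proof -
  have "omega w v = (transpose Omega *v w) \<bullet> v"
    by (simp add: omega_def dot_lmul_matrix)
  then show ?thesis
    by (simp add: transpose_Omega matrix_vector_mult_minus_left omega_def inner_commute)
qed

lemma omega_self: "omega v v = 0"
  using omega_commute[of v v] by simp

lemma omega_nondegenerate:
  assumes "v \<noteq> 0"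
  obtains w where "omega v w \<noteq> 0"
proof
  \<comment> \<open>As \<open>Omega\<close> squares to minus the identity, this value is minus the
    squared norm of \<open>v\<close>.\<close>
  show "omega v (Omega *v v) \<noteq> 0"
    using assms
    by (simp add: omega_def matrix_vector_mul_assoc Omega_mult_Omega matrix_vector_mult_minus_left)
qed

text \<open>The kernels of \<open>omega v\<close> and \<open>omega v'\<close> are proper subspaces,
  and two proper subspaces never cover the space: if neither witness serves both, their sum
  does.\<close>

lemma omega_nondegenerate2:
  assumes "v \<noteq> 0" "v' \<noteq> 0"
  obtains w where "omega v w \<noteq> 0" "omega v' w \<noteq> 0"
proof -
  obtain w1 where w1: "omega v w1 \<noteq> 0" using assms(1) by (rule omega_nondegenerate)
  obtain w2 where w2: "omega v' w2 \<noteq> 0" using assms(2) by (rule omega_nondegenerate)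
  show ?thesis
  proof (cases "omega v' w1 = 0")
    case False
    with w1 show ?thesis by (rule that)
  next
    case True
    show ?thesis
    proof (cases "omega v w2 = 0")
      case False
      from this w2 show ?thesis by (rule that)
    next
      case v: True
      show ?thesis
        by (rule that[of "w1 + w2"]) (use w1 w2 True v in \<open>simp_all add: omega_add_right\<close>)
    qed
  qed
qed

lemma omega_nonzero: obtains v w :: "real ^ ('n::finite \<times> 2)" where "omega v w \<noteq> 0"
proof -
  \<comment> \<open>Here N \<ge> 1 enters: the index type is inhabited, so a unit vector exists at
    an arbitrary index.\<close>
  have "(axis undefined 1 :: real ^ ('n \<times> 2)) \<noteq> 0"
    by (simp add: axis_eq_0_iff)
  then show ?thesis
    using omega_nondegenerate that by blast
qed

section \<open>The squares \<open>sq v\<close> and the Lie algebra \<open>sp\<close>\<close>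

definition sq :: "real ^ ('n::finite \<times> 2) \<Rightarrow> 'n mat2N" where
  "sq v = outer v v ** Omega"

lemma sq_mult_vector: "sq v *v w = omega v w *\<^sub>R v"
  by (simp add: sq_def omega_def outer_mult_vector flip: matrix_vector_mul_assoc)

lemma sq_eq_0_iff: "sq v = 0 \<longleftrightarrow> v = 0"
proof
  assume sq: "sq v = 0"
  show "v = 0"
  proof (rule ccontr)
    assume "v \<noteq> 0"
    then obtain w where "omega v w \<noteq> 0" by (rule omega_nondegenerate)
    with \<open>v \<noteq> 0\<close> sq_mult_vector[of v w] sq show False by simp
  qed
qed (simp add: sq_def outer_def vec_eq_iff matrix_matrix_mult_def)

lemma sq_scaleR: "sq (r *\<^sub>R v) = r\<^sup>2 *\<^sub>R sq v"
  by (simp add: sq_def outer_scaleR_left outer_scaleR_right power2_eq_square scalar_matrix_assoc)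

lemma sq_parallelogram: "sq (v + w) + sq (v - w) = 2 *\<^sub>R (sq v + sq w)"
proof -
  have "outer (v + w) (v + w) + outer (v - w) (v - w) = 2 *\<^sub>R (outer v v + outer w w)"
    by (simp add: outer_def vec_eq_iff algebra_simps)
  then show ?thesis
    by (simp add: sq_def scalar_matrix_assoc flip: matrix_add_rdistrib)
qed

text \<open>The product is \<open>omega v w\<close> times \<open>outer v w ** Omega\<close>, whose
  trace is \<open>omega w v\<close>; antisymmetry supplies the minus sign.\<close>

lemma trace_sq_mult_sq: "trace (sq v ** sq w) = - (omega v w)\<^sup>2"
proof -
  have "sq v ** sq w = omega v w *\<^sub>R (outer v w ** Omega)"
    unfolding sq_def[of w]
    by (simp add: matrix_mul_assoc matrix_mult_outer sq_mult_vector outer_scaleR_left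
        scalar_matrix_assoc)
  moreover have "trace (outer v w ** Omega) = omega w v"
    by (subst trace_mul_sym) (simp add: matrix_mult_outer trace_outer omega_def inner_commute)
  ultimately show ?thesis
    by (simp add: trace_scaleR omega_commute[of w v] power2_eq_square)
qed

lemma subspace_sp: "subspace (sp :: 'n::finite mat2N set)"
proof (rule subspaceI)
  show "(0 :: 'n mat2N) \<in> sp"
    by (simp add: sp_def vec_eq_iff matrix_matrix_mult_def transpose_def)
next
  fix X Y :: "'n mat2N"
  assume "X \<in> sp" "Y \<in> sp"
  moreover have "(X + Y) ** Omega + Omega ** transpose (X + Y)
      = (X ** Omega + Omega ** transpose X) + (Y ** Omega + Omega ** transpose Y)"
    by (simp add: vec_eq_iff matrix_matrix_mult_def transpose_def algebra_simps sum.distrib)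
  ultimately show "X + Y \<in> sp"
    by (simp add: sp_def)
next
  fix r and X :: "'n mat2N"
  assume "X \<in> sp"
  moreover have "(r *\<^sub>R X) ** Omega + Omega ** transpose (r *\<^sub>R X)
      = r *\<^sub>R (X ** Omega + Omega ** transpose X)"
    by (simp add: transpose_scalar matrix_scalar_ac scalar_matrix_assoc scaleR_add_right)
  ultimately show "r *\<^sub>R X \<in> sp"
    by (simp add: sp_def)
qed

lemma Omega_cancel: "Omega ** (Omega ** A) = - A" "A ** Omega ** Omega = - A"
  for A :: "'n::finite mat2N"
  by (simp_all add: matrix_mul_assoc Omega_mult_Omega matrix_mult_minus_left)
    (simp add: Omega_mult_Omega matrix_mult_minus_right flip: matrix_mul_assoc)

lemma sq_in_sp: "sq v \<in> sp"
proof -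
  have "Omega ** transpose (sq v) = - (Omega ** (Omega ** outer v v))"
    by (simp add: sq_def matrix_transpose_mul transpose_outer transpose_Omega
        matrix_mult_minus_left matrix_mult_minus_right)
  then show ?thesis
    by (simp add: sp_def sq_def Omega_cancel)
qed

text \<open>Multiplication by \<open>Omega\<close> identifies \<open>sp\<close> with the symmetric
  matrices: \<open>A = - (X ** Omega)\<close> is symmetric and \<open>X = A ** Omega\<close>. Under
  this map \<open>outer v v\<close> becomes \<open>sq v\<close>.\<close>

lemma sp_subset_span_sq: "(sp :: 'n::finite mat2N set) \<subseteq> span (range sq)"
proof
  fix X :: "'n mat2N"
  assume "X \<in> sp"
  then have X: "Omega ** transpose X = - (X ** Omega)"
    by (simp add: sp_def eq_neg_iff_add_eq_0 add.commute)
  define A where "A = - (X ** Omega)"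
  have "transpose A = A"
    by (simp add: A_def transpose_minus matrix_transpose_mul transpose_Omega X
        matrix_mult_minus_left)
  then have "A \<in> span (range (\<lambda>v. outer v v))"
    by (rule symmetric_matrix_in_span_squares)
  moreover have lin: "linear (\<lambda>A. A ** (Omega :: 'n mat2N))"
    by (rule linearI) (simp_all add: matrix_add_rdistrib scalar_matrix_assoc)
  ultimately have "A ** Omega \<in> span ((\<lambda>A. A ** Omega) ` range (\<lambda>v. outer v v))"
    unfolding linear_span_image[OF lin] by (intro imageI)
  moreover have "A ** Omega = X"
    by (simp add: A_def matrix_mult_minus_left Omega_cancel)
  ultimately show "X \<in> span (range sq)"
    by (simp add: image_image sq_def[abs_def])
qed

section \<open>The adjoint action and symplectic transvections\<close>

lemma Omega_mult_matrix_inv: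
  assumes "S \<in> Sp"
  shows "Omega ** matrix_inv S = transpose S ** Omega"
proof -
  define T where "T = - (Omega ** transpose S ** Omega)"
  have ST: "S ** T = mat 1"
    using assms by (simp add: T_def Sp_def matrix_mul_assoc matrix_mult_minus_right Omega_mult_Omega)
  then have TS: "T ** S = mat 1"
    by (simp add: matrix_left_right_inverse)
  \<comment> \<open>\<open>matrix_inv\<close> is a choice operator, so a two-sided inverse has to be
    exhibited before its defining property is available.\<close>
  with ST have "S ** matrix_inv S = mat 1"
    unfolding matrix_inv_def by (metis (mono_tags, lifting) someI_ex)
  with TS have "matrix_inv S = T"
    by (metis matrix_mul_assoc matrix_mul_lid matrix_mul_rid)
  then show ?thesis
    by (simp add: T_def matrix_mult_minus_right Omega_cancel flip: matrix_mul_assoc)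
qed

lemma Ad_sq:
  assumes "S \<in> Sp"
  shows "Ad S (sq v) = sq (S *v v)"
proof -
  have "Ad S (sq v) = S ** outer v v ** (Omega ** matrix_inv S)"
    by (simp add: Ad_def sq_def matrix_mul_assoc)
  also have "\<dots> = S ** outer v v ** transpose S ** Omega"
    by (simp add: Omega_mult_matrix_inv assms matrix_mul_assoc)
  also have "\<dots> = sq (S *v v)"
    by (simp add: matrix_mult_outer outer_mult_matrix sq_def)
  finally show ?thesis .
qed

definition transvection :: "real \<Rightarrow> real ^ ('n::finite \<times> 2) \<Rightarrow> 'n mat2N" where
  "transvection r u = mat 1 + r *\<^sub>R sq u"

lemma transvection_mult_vector: "transvection r u *v w = w + (r * omega u w) *\<^sub>R u"
  by (simp add: transvection_def matrix_vector_mult_add_rdistrib sq_mult_vector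
      flip: scaleR_matrix_vector_assoc)

text \<open>For \<open>X = r *\<^sub>R sq u\<close> in \<open>sp\<close>, the defect from preserving
  \<open>Omega\<close> is \<open>X ** X ** Omega\<close>, and \<open>X ** X = 0\<close> because
  \<open>omega u u = 0\<close>.\<close>

lemma transvection_in_Sp: "transvection r u \<in> Sp"
proof -
  define X where "X = r *\<^sub>R sq u"
  have "X \<in> sp"
    by (simp add: X_def subspace_scale subspace_sp sq_in_sp)
  then have X: "Omega ** transpose X = - (X ** Omega)"
    by (simp add: sp_def eq_neg_iff_add_eq_0 add.commute)
  have "sq u ** sq u = outer (sq u *v u) u ** Omega"
    by (metis sq_def matrix_mul_assoc matrix_mult_outer)
  also have "\<dots> = 0"
    by (simp add: sq_mult_vector omega_self) (simp add: outer_def vec_eq_iff matrix_matrix_mult_def)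
  finally have "sq u ** sq u = 0" .
  then have "X ** X = 0"
    by (simp add: X_def matrix_scalar_ac flip: scalar_matrix_assoc)
  moreover have "(mat 1 + X) ** Omega ** transpose (mat 1 + X) = Omega - X ** X ** Omega"
  proof -
    have "Omega ** transpose (mat 1 + X) = Omega - X ** Omega"
      by (simp add: transpose_add matrix_add_ldistrib X)
    then have "(mat 1 + X) ** Omega ** transpose (mat 1 + X) = (mat 1 + X) ** (Omega - X ** Omega)"
      by (simp flip: matrix_mul_assoc)
    also have "\<dots> = Omega - X ** X ** Omega"
      by (simp add: matrix_add_rdistrib matrix_diff_ldistrib matrix_mul_assoc)
    finally show ?thesis .
  qed
  ultimately have "(mat 1 + X) ** Omega ** transpose (mat 1 + X) = Omega"
    by (simp add: matrix_mult_0_left)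
  then show ?thesis
    by (simp add: Sp_def transvection_def X_def)
qed

section \<open>Invariant forms are multiples of the trace form\<close>

locale Ad_invariant_form =
  fixes b :: "'n::finite mat2N \<Rightarrow> 'n mat2N \<Rightarrow> real"
  assumes bilinear: "bilinear_form_on sp b"
    and symmetric: "symmetric_form_on sp b"
    and invariant: "\<And>S X Y. S \<in> Sp \<Longrightarrow> X \<in> sp \<Longrightarrow> Y \<in> sp \<Longrightarrow> b (Ad S X) (Ad S Y) = b X Y"
begin

definition f :: "real ^ ('n \<times> 2) \<Rightarrow> real ^ ('n \<times> 2) \<Rightarrow> real" where
  "f v w = b (sq v) (sq w)"

lemma f_commute: "f v w = f w v"
  using symmetric by (simp add: f_def symmetric_form_on_def sq_in_sp)

lemma f_scaleR_right: "f v (r *\<^sub>R w) = r\<^sup>2 * f v w"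
  using bilinear by (simp add: f_def bilinear_form_on_def sq_in_sp sq_scaleR)

lemma f_parallelogram: "f v (w + u) + f v (w - u) = 2 * (f v w + f v u)"
proof -
  have "f v (w + u) + f v (w - u) = b (sq v) (sq (w + u) + sq (w - u))"
    using bilinear by (simp add: f_def bilinear_form_on_def sq_in_sp)
  also have "\<dots> = 2 * (f v w + f v u)"
    using bilinear
    by (simp add: f_def sq_parallelogram bilinear_form_on_def sq_in_sp subspace_add subspace_sp)
  finally show ?thesis .
qed

lemma f_Sp: "S \<in> Sp \<Longrightarrow> f (S *v v) (S *v w) = f v w"
  using invariant[of S "sq v" "sq w"] by (simp add: f_def Ad_sq sq_in_sp)

lemma f_cong_transvection:
  assumes "omega v w = omega v w'" and "omega w w' \<noteq> 0"
  shows "f v w = f v w'"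
proof -
  \<comment> \<open>Since \<open>omega (w' - w) w = omega w' w\<close>, this coefficient makes the
    transvection add exactly \<open>w' - w\<close> to \<open>w\<close>. It fixes \<open>v\<close>
    because \<open>omega (w' - w) v = 0\<close>.\<close>
  let ?T = "transvection (1 / omega w' w) (w' - w)"
  have "omega w' w \<noteq> 0"
    using assms(2) omega_commute[of w' w] by simp
  then have "?T *v w = w'"
    by (simp add: transvection_mult_vector omega_diff_left omega_self)
  moreover have "omega (w' - w) v = 0"
    using assms(1) by (simp add: omega_commute[of _ v] omega_diff_right)
  then have "?T *v v = v"
    by (simp add: transvection_mult_vector)
  ultimately show ?thesis
    using f_Sp[OF transvection_in_Sp, of _ _ v w] by metis
qed

text \<open>
  If \<open>\<omega>(w, w') = 0\<close> and \<open>w \<noteq> w'\<close>, no transvection along \<open>w' - w\<close> takes \<open>w\<close> to \<open>w'\<close>, but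
  two transvections via \<open>w + v\<close> do.
\<close>

lemma f_cong:
  assumes "omega v w = omega v w'" and "omega v w \<noteq> 0"
  shows "f v w = f v w'"
proof (cases "omega w w' = 0")
  case False
  with assms(1) show ?thesis by (rule f_cong_transvection)
next
  case True
  have "f v w = f v (w + v)"
    by (rule f_cong_transvection)
      (use assms(2) omega_commute[of w v] in \<open>simp_all add: omega_add_right omega_self\<close>)
  also have "\<dots> = f v w'"
    by (rule f_cong_transvection)
      (use assms True in \<open>simp_all add: omega_add_right omega_add_left omega_self\<close>)
  finally show ?thesis .
qed

text \<open>Rescaling \<open>w\<close> to give it the same \<open>omega\<close>-value as
  \<open>w'\<close> reduces this to \<open>f_cong\<close>; the factor comes out squared by
  homogeneity.\<close>

lemma f_ratio:
  assumes "omega v w \<noteq> 0" and "omega v w' \<noteq> 0"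
  shows "f v w / (omega v w)\<^sup>2 = f v w' / (omega v w')\<^sup>2"
proof -
  let ?r = "omega v w' / omega v w"
  have "f v (?r *\<^sub>R w) = f v w'"
    by (rule f_cong) (use assms in \<open>simp_all add: omega_scaleR_right\<close>)
  then show ?thesis
    using assms by (simp add: f_scaleR_right field_simps)
qed

lemma f_eq_omega_square: "\<exists>c. \<forall>v w. f v w = c * (omega v w)\<^sup>2"
proof -
  let ?q = "\<lambda>v w. f v w / (omega v w)\<^sup>2"
  have q_commute: "?q v w = ?q w v" for v w
    using omega_commute[of w v] f_commute[of v w] by simp
  obtain v0 w0 :: "real ^ ('n \<times> 2)" where 0: "omega v0 w0 \<noteq> 0"
    by (rule omega_nonzero)
  have generic: "f v w = ?q v0 w0 * (omega v w)\<^sup>2" if vw: "omega v w \<noteq> 0" for v w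
  proof -
    have "v0 \<noteq> 0" "v \<noteq> 0"
      using 0 vw by (auto simp: omega_def)
    then obtain u where u: "omega v0 u \<noteq> 0" "omega v u \<noteq> 0"
      by (rule omega_nondegenerate2)
    then have u': "omega u v0 \<noteq> 0" "omega u v \<noteq> 0"
      by (simp_all add: omega_commute[of u])
    \<comment> \<open>The ratio \<open>?q\<close> is symmetric and independent of its second
      argument, so each argument can be exchanged in turn. The vector \<open>u\<close> pairs
      nontrivially with both \<open>v\<close> and \<open>v0\<close> and links the two pairs.\<close>
    have "?q v w = ?q u v"
      using f_ratio[OF vw u(2)] q_commute by simp
    also have "\<dots> = ?q u v0"
      by (rule f_ratio) (fact u')+
    also have "\<dots> = ?q v0 w0"
      using f_ratio[OF 0 u(1)] q_commute by simp
    finally show ?thesis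
      using vw by (simp add: field_simps)
  qed
  have "f v w = ?q v0 w0 * (omega v w)\<^sup>2" for v w
  proof (cases "omega v w = 0")
    case False
    then show ?thesis by (rule generic)
  next
    case True
    show ?thesis
    proof (cases "v = 0")
      case True
      \<comment> \<open>Homogeneity with factor 0 gives \<open>f w 0 = 0\<close>.\<close>
      then show ?thesis
        using f_scaleR_right[of w 0 0] by (simp add: f_commute[of 0] omega_def)
    next
      case False
      \<comment> \<open>Both \<open>w + u\<close> and \<open>w - u\<close> are generic for
        \<open>v\<close>, with \<open>omega\<close>-values of opposite sign and equal square. The
        parallelogram law then forces \<open>f v w = 0\<close>.\<close>
      then obtain u where "omega v u \<noteq> 0" by (rule omega_nondegenerate)
      then show ?thesis
        using f_parallelogram[of v w u] True
        by (simp add: generic omega_add_right omega_diff_right)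
    qed
  qed
  then show ?thesis by blast
qed

text \<open>The difference \<open>?D\<close> of the two forms is bilinear on \<open>sp\<close>, so
  vanishing on squares extends to their span, first in the left and then in the right argument. The
  kernels are taken inside \<open>sp\<close> because \<open>b\<close> is unconstrained
  elsewhere.\<close>

lemma eq_trace_on_squares_imp_eq_trace:
  assumes "\<And>v w. b (sq v) (sq w) = c * trace (sq v ** sq w)"
    and X: "X \<in> sp" and Y: "Y \<in> sp"
  shows "b X Y = c * trace (X ** Y)"
proof -
  let ?D = "\<lambda>X Y. b X Y - c * trace (X ** Y)"
  have add_left: "?D (X + Y) Z = ?D X Z + ?D Y Z"
    and add_right: "?D Z (X + Y) = ?D Z X + ?D Z Y"
    and scale_left: "?D (r *\<^sub>R X) Y = r * ?D X Y"
    and scale_right: "?D X (r *\<^sub>R Y) = r * ?D X Y"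
    if "X \<in> sp" "Y \<in> sp" "Z \<in> sp" for X Y Z r
    using bilinear that
    by (simp_all add: bilinear_form_on_def matrix_add_rdistrib matrix_add_ldistrib trace_add
        matrix_scalar_ac trace_scaleR algebra_simps flip: scalar_matrix_assoc)
  have 0: "(0 :: 'n mat2N) \<in> sp"
    by (rule subspace_0[OF subspace_sp])
  have left: "subspace {X \<in> sp. ?D X Y = 0}" if "Y \<in> sp" for Y
  proof (rule subspaceI)
    show "0 \<in> {X \<in> sp. ?D X Y = 0}"
      using scale_left[OF 0 that that, of 0] 0 by simp
  qed (use subspace_sp that in
      \<open>auto simp: add_left scale_left simp del: right_minus_eq
        intro: subspace_add subspace_scale\<close>)
  have right: "subspace {Y \<in> sp. ?D X Y = 0}" if "X \<in> sp" for X
  proof (rule subspaceI)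
    show "0 \<in> {Y \<in> sp. ?D X Y = 0}"
      using scale_right[OF that 0 that, of 0] 0 by simp
  qed (use subspace_sp that in
      \<open>auto simp: add_right scale_right simp del: right_minus_eq
        intro: subspace_add subspace_scale\<close>)
  have sq: "?D X (sq w) = 0" if "X \<in> sp" for X w
  proof -
    have "span (range sq) \<subseteq> {X \<in> sp. ?D X (sq w) = 0}"
      by (rule span_minimal) (auto simp: assms(1) left sq_in_sp simp del: right_minus_eq)
    with that sp_subset_span_sq show ?thesis by blast
  qed
  have "span (range sq) \<subseteq> {Y \<in> sp. ?D X Y = 0}"
    by (rule span_minimal) (auto simp: sq X right sq_in_sp simp del: right_minus_eq)
  with Y sp_subset_span_sq have "?D X Y = 0" by blast
  then show ?thesis by simp
qed

lemma eq_scaled_trace: "\<exists>c. \<forall>X\<in>sp. \<forall>Y\<in>sp. b X Y = c * trace (X ** Y)"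
proof -
  obtain c where "f v w = c * (omega v w)\<^sup>2" for v w
    using f_eq_omega_square by blast
  then have "b (sq v) (sq w) = - c * trace (sq v ** sq w)" for v w
    by (simp add: f_def trace_sq_mult_sq)
  then show ?thesis
    using eq_trace_on_squares_imp_eq_trace by blast
qed

end

section \<open>Signs of the trace form and definiteness\<close>

lemma trace_square_sq_add: "trace ((sq v + sq w) ** (sq v + sq w)) = - 2 * (omega v w)\<^sup>2"
  and trace_square_sq_diff: "trace ((sq v - sq w) ** (sq v - sq w)) = 2 * (omega v w)\<^sup>2"
proof -
  \<comment> \<open>The terms \<open>trace (sq v ** sq v)\<close> and
    \<open>trace (sq w ** sq w)\<close> vanish by \<open>omega_self\<close>; only the two equal
    cross terms remain.\<close>
  have *: "trace ((sq v + r *\<^sub>R sq w) ** (sq v + r *\<^sub>R sq w)) = - 2 * r * (omega v w)\<^sup>2" for r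
    by (simp add: matrix_add_rdistrib matrix_add_ldistrib trace_add matrix_scalar_ac trace_scaleR
        trace_sq_mult_sq omega_self omega_commute[of w v] flip: scalar_matrix_assoc)
  show "trace ((sq v + sq w) ** (sq v + sq w)) = - 2 * (omega v w)\<^sup>2"
    using *[of 1] by simp
  show "trace ((sq v - sq w) ** (sq v - sq w)) = 2 * (omega v w)\<^sup>2"
    using *[of "- 1"] by simp
qed

text \<open>If \<open>c = 0\<close>, every vector is in the radical, in particular the nonzero
  \<open>sq v\<close>. Otherwise \<open>sq v + sq w\<close> and \<open>sq v - sq w\<close> witness
  the two signs, in an order set by the sign of \<open>c\<close>.\<close>

lemma scaled_trace_degenerate_or_indefinite:
  fixes b :: "'n::finite mat2N \<Rightarrow> 'n mat2N \<Rightarrow> real"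
  assumes b: "\<And>X Y. X \<in> sp \<Longrightarrow> Y \<in> sp \<Longrightarrow> b X Y = c * trace (X ** Y)"
  shows "degenerate_on sp b \<or> indefinite_on sp b"
proof -
  obtain v w :: "real ^ ('n \<times> 2)" where vw: "omega v w \<noteq> 0"
    by (rule omega_nonzero)
  then have "sq v \<noteq> 0"
    by (auto simp: sq_eq_0_iff omega_def)
  have sum: "sq v + sq w \<in> sp" and diff: "sq v - sq w \<in> sp"
    by (simp_all add: subspace_add subspace_diff subspace_sp sq_in_sp)
  have *: "b (sq v + sq w) (sq v + sq w) = - 2 * c * (omega v w)\<^sup>2"
    "b (sq v - sq w) (sq v - sq w) = 2 * c * (omega v w)\<^sup>2"
    using sum diff by (simp_all add: b trace_square_sq_add trace_square_sq_diff)
  have pos: "(omega v w)\<^sup>2 > 0"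
    using vw by simp
  consider "c = 0" | "c > 0" | "c < 0" by linarith
  then show ?thesis
  proof cases
    case 1
    then have "degenerate_on sp b"
      using \<open>sq v \<noteq> 0\<close> sq_in_sp[of v] by (auto simp: degenerate_on_def b)
    then show ?thesis ..
  next
    case 2
    with pos * have "b (sq v - sq w) (sq v - sq w) > 0" "b (sq v + sq w) (sq v + sq w) < 0"
      by (simp_all add: mult_neg_pos)
    with sum diff show ?thesis
      by (auto simp: indefinite_on_def)
  next
    case 3
    with pos * have "b (sq v + sq w) (sq v + sq w) > 0" "b (sq v - sq w) (sq v - sq w) < 0"
      by (simp_all add: mult_neg_pos)
    with sum diff show ?thesis
      by (auto simp: indefinite_on_def)
  qed
qed

text \<open>A nonzero radical vector has value 0 on the diagonal. In the indefinite case the vector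
  of negative value is nonzero by the assumption on \<open>b 0 0\<close>.\<close>

lemma not_positive_definite_if_degenerate_or_indefinite:
  assumes "degenerate_on V b \<or> indefinite_on V b"
    and "0 \<in> V \<Longrightarrow> b 0 0 = 0"
  shows "\<not> positive_definite_on V b"
  using assms by (force simp: degenerate_on_def indefinite_on_def positive_definite_on_def)

theorem proposition2p4:
  fixes b :: "'n::finite mat2N \<Rightarrow> 'n mat2N \<Rightarrow> real"
  assumes "bilinear_form_on sp b"
    and "symmetric_form_on sp b"
    and "\<And>S X Y. S \<in> Sp \<Longrightarrow> X \<in> sp \<Longrightarrow> Y \<in> sp \<Longrightarrow> b (Ad S X) (Ad S Y) = b X Y"
  shows "(\<exists>c::real. \<forall>X\<in>sp. \<forall>Y\<in>sp. b X Y = c * trace (X ** Y)) \<and>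
         (degenerate_on sp b \<or> indefinite_on sp b) \<and>
         \<not> positive_definite_on sp b \<and>
         \<not> quadratic_Nielsen_cost_on sp (\<lambda>X. b X X)"
proof -
  interpret Ad_invariant_form b
    by unfold_locales (use assms in auto)
  obtain c where c: "\<And>X Y. X \<in> sp \<Longrightarrow> Y \<in> sp \<Longrightarrow> b X Y = c * trace (X ** Y)"
    using eq_scaled_trace by blast
  have deg: "degenerate_on sp b \<or> indefinite_on sp b"
    using c by (rule scaled_trace_degenerate_or_indefinite)
  have "(0 :: 'n mat2N) \<in> sp \<Longrightarrow> b 0 0 = 0"
    by (simp add: c matrix_mult_0_left trace_def)
  with deg have npos: "\<not> positive_definite_on sp b"
    by (rule not_positive_definite_if_degenerate_or_indefinite)
  \<comment> \<open>A form \<open>q\<close> representing the cost agrees with \<open>b\<close> on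
    the diagonal, so its positivity would pass to \<open>b\<close>.\<close>
  then have "\<not> quadratic_Nielsen_cost_on sp (\<lambda>X. b X X)"
    by (auto simp: quadratic_Nielsen_cost_on_def positive_definite_on_def)
  with c deg npos show ?thesis by blast
qed

end
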